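(* Let $d\ge3$ be an integer, and let $h(t)=\binom{t+d}{d}=\sum_{j=0}^d h_jt^j$, $f(t)=\binom{t+d}{d}-\binom{t}{d}=\sum_{j=0}^d f_jt^j$ and $g(t)=\binom{t+d}{d+1}-\binom{t}{d+1}=\sum_{j=0}^d g_jt^j$. Let $r=1$ if $d$ is odd and $r=2$ if $d$ is even. For $p\in\{f,h\}$ with coefficients $p_j$, set $$K_p(d)=\max\left\{1,\;1+\left\lfloor\max\left\{\frac{p_{r+1}-p_r}{g_r},\frac{p_{r+1}-p_{r+2}}{g_{r+2}}\right\}\right\rfloor\right\}.$$ Let $k$ be a positive integer and let $S_{\mathbf a}\subset\mathbb R^d$ be the one-row Hermite normal form simplex associated with $\mathbf a=(N-1,\ldots,N-1,N)\in\mathbb N^d$. If $N=dk+1$ and $k\ge K_h(d)$, then the Ehrhart polynomial of $S_{\mathbf a}$ is not unimodal. If $N=dk$ and $k\ge K_f(d)$, then the Ehrhart polynomial of $S_{\mathbf a}$ is not unimodal.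
   Context: For $\mathbf a=(a_1,\ldots,a_{d-1},N)\in\mathbb Z^d$ with $0\le a_i<N$, the one-row Hermite normal form simplex $S_{\mathbf a}$ is the convex hull in $\mathbb R^d$ of $\mathbf v_0=\mathbf 0$, $\mathbf v_i=\mathbf e_i$ (standard unit vectors) for $1\le i\le d-1$, and $\mathbf v_d=\mathbf a$. Binomial coefficients $\binom{t+c}{n}$ are regarded as polynomials in the indeterminate $t$: $\binom{t+c}{n}=\frac{1}{n!}\prod_{i=0}^{n-1}(t+c-i)$. For a $d$-dimensional lattice polytope $P\subset\mathbb R^d$, the Ehrhart polynomial $\mathcal L_P$ is the polynomial of degree $d$ with $\mathcal L_P(m)=|mP\cap\mathbb Z^d|$ for all integers $m\ge0$. A polynomial $\sum_{j=0}^d\ell_jt^j$ is unimodal if there is an index $0\le i\le d$ with $\ell_0\le\cdots\le\ell_i\ge\cdots\ge\ell_d$. *)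

theory Defs
  imports "HOL-Analysis.Analysis" "HOL-Computational_Algebra.Polynomial"
begin

definition binom_poly :: "nat \<Rightarrow> nat \<Rightarrow> real poly" where
  "binom_poly c n = smult (1 / fact n) (\<Prod>i<n. [:real c - real i, 1:])"

lemma poly_binom_poly: "poly (binom_poly c n) t = (t + real c) gchoose n"
  by (simp add: binom_poly_def poly_prod gbinomial_prod_rev atLeast0LessThan algebra_simps)

definition h_poly :: "nat \<Rightarrow> real poly" where
  "h_poly d = binom_poly d d"

definition f_poly :: "nat \<Rightarrow> real poly" where
  "f_poly d = binom_poly d d - binom_poly 0 d"

definition g_poly :: "nat \<Rightarrow> real poly" where
  "g_poly d = binom_poly d (d + 1) - binom_poly 0 (d + 1)"

definition r_index :: "nat \<Rightarrow> nat" where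
  "r_index d = (if odd d then 1 else 2)"

definition K_bound :: "real poly \<Rightarrow> nat \<Rightarrow> int" where
  "K_bound p d =
    (let r = r_index d; g = g_poly d in
      max 1 (1 + \<lfloor>max ((coeff p (r + 1) - coeff p r) / coeff g r)
                       ((coeff p (r + 1) - coeff p (r + 2)) / coeff g (r + 2))\<rfloor>))"

text \<open>The coordinates of \<open>\<real>\<^sup>d\<close> are indexed by a finite linearly ordered type with \<open>d\<close> elements;
  the distinguished \<open>d\<close>-th coordinate is the greatest index.\<close>

definition last_index :: "'n::{finite,linorder}" where
  "last_index = Max UNIV"

definition one_row_hnf_simplex :: "int ^ 'n::{finite,linorder} \<Rightarrow> (real ^ 'n::{finite,linorder}) set" where
  "one_row_hnf_simplex a =
    convex hull ({0} \<union> {axis i 1 | i. i \<noteq> last_index} \<union> {\<chi> i. real_of_int (a $ i)})"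

definition integer_points :: "(real ^ 'n::finite) set" where
  "integer_points = {x. \<forall>i. x $ i \<in> \<int>}"

definition is_ehrhart_poly :: "(real ^ 'n::finite) set \<Rightarrow> real poly \<Rightarrow> bool" where
  "is_ehrhart_poly P p \<longleftrightarrow>
    degree p = CARD('n) \<and>
    (\<forall>m::nat. poly p (real m) = real (card ((\<lambda>x. real m *\<^sub>R x) ` P \<inter> integer_points)))"

lemma is_ehrhart_poly_unique:
  assumes "is_ehrhart_poly P p" "is_ehrhart_poly P q"
  shows "p = q"
proof (rule ccontr)
  assume "p \<noteq> q"
  then have "finite {x. poly (p - q) x = 0}"
    by (intro poly_roots_finite) simp
  moreover have "range real \<subseteq> {x. poly (p - q) x = 0}"
    using assms by (auto simp: is_ehrhart_poly_def)
  ultimately have "finite (range real)"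
    by (rule rev_finite_subset)
  then show False
    by (simp add: finite_image_iff)
qed

text \<open>Meaningful only for full-dimensional lattice polytopes, where existence is Ehrhart's theorem.\<close>

definition ehrhart_poly :: "(real ^ 'n::finite) set \<Rightarrow> real poly" where
  "ehrhart_poly P = (THE p. is_ehrhart_poly P p)"

lemma ehrhart_poly_eqI: "is_ehrhart_poly P p \<Longrightarrow> ehrhart_poly P = p"
  unfolding ehrhart_poly_def by (blast intro: the_equality is_ehrhart_poly_unique)

definition unimodal_poly :: "nat \<Rightarrow> real poly \<Rightarrow> bool" where
  "unimodal_poly d p \<longleftrightarrow>
    (\<exists>i\<le>d. (\<forall>j<i. coeff p j \<le> coeff p (j + 1)) \<and>
           (\<forall>j. i \<le> j \<and> j < d \<longrightarrow> coeff p j \<ge> coeff p (j + 1)))"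

end

theory Submission
  imports Defs
begin

text \<open>The barycentric coordinates of an integer point with respect to \<open>S\<^sub>\<a>\<close> are \<open>y\<^sub>i + s / N\<close> with
  integers \<open>y\<^sub>i\<close> and a common residue \<open>0 \<le> s < N\<close>. Hence the number of lattice points of the \<open>m\<close>-fold
  dilate is \<open>\<Sum>s<N. binomial (m + d - \<lceil>d s / N\<rceil>) d\<close>. For \<open>N = d k + 1\<close> and \<open>N = d k\<close> every value in
  \<open>1..d\<close> of \<open>\<lceil>d s / N\<rceil>\<close> is taken \<open>k\<close> times, except that in the second case \<open>d\<close> is taken only \<open>k - 1\<close>
  times; the hockey-stick identity then gives the Ehrhart polynomials \<open>h + k g\<close> and \<open>f + k g\<close>.
  Now \<open>(d + 1)! g(t) = t (\<Prod>i=1..d. t + i) - t (\<Prod>i=1..d. t - i)\<close>, so every second coefficient of \<open>g\<close>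
  vanishes and the others are positive. For large \<open>k\<close> this forces a strict local minimum at the
  coefficient of index \<open>r + 1\<close>.\<close>

section \<open>Lattice points of dilated standard simplices\<close>

text \<open>Reflecting the index \<open>v\<close> to \<open>n - v\<close> turns the sum into the
  hockey-stick identity. This is the recursion step when one coordinate is split off.\<close>

lemma sum_choose_diff_eq: "(\<Sum>v\<le>n. (n - v + a) choose a) = (n + Suc a) choose Suc a"
proof -
  have "(\<Sum>v\<le>n. (n - v + a) choose a) = (\<Sum>v\<le>n. (a + v) choose v)"
    using sum.nat_diff_reindex[of "\<lambda>v. (a + v) choose v" "Suc n"]
    by (simp add: lessThan_Suc_atMost binomial_symmetric[of a] add.commute)
  also have "\<dots> = (n + Suc a) choose Suc a"
    using sum_choose_lower[of a n] binomial_symmetric[of n "n + Suc a"] by (simp add: add.commute)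
  finally show ?thesis .
qed

text \<open>Giving the new coordinate \<open>x\<close> the value \<open>v\<close> leaves a function
  on \<open>A\<close> with sum at most \<open>n - v\<close>, so the counts obey the hockey-stick
  recursion. Extensional functions allow the induction on the index set.\<close>

lemma card_PiE_sum_le:
  assumes "finite A"
  shows "card {f \<in> A \<rightarrow>\<^sub>E (UNIV :: nat set). sum f A \<le> n} = (n + card A) choose card A"
  using assms
proof (induction A arbitrary: n rule: finite_induct)
  case empty
  then show ?case by simp
next
  case (insert x A)
  let ?S = "\<lambda>A n. {f \<in> A \<rightarrow>\<^sub>E (UNIV :: nat set). sum f A \<le> n}"
  have upd: "(\<Sum>z\<in>A. if z = x then v else f z) = sum f A" for f and v :: nat
    using insert.hyps by (intro sum.cong) auto
  have "bij_betw (\<lambda>(v, f). f(x := v)) (SIGMA v:{..n}. ?S A (n - v)) (?S (insert x A) n)"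
  proof (rule bij_betw_byWitness[where f' = "\<lambda>f. (f x, f(x := undefined))"])
    show "\<forall>p\<in>(SIGMA v:{..n}. ?S A (n - v)).
        (\<lambda>f. (f x, f(x := undefined))) ((\<lambda>(v, f). f(x := v)) p) = p"
      using insert.hyps by (auto simp: fun_eq_iff PiE_def extensional_def)
    show "\<forall>f\<in>?S (insert x A) n. (\<lambda>(v, f). f(x := v)) ((\<lambda>f. (f x, f(x := undefined))) f) = f"
      by auto
    show "(\<lambda>(v, f). f(x := v)) ` (SIGMA v:{..n}. ?S A (n - v)) \<subseteq> ?S (insert x A) n"
      using insert.hyps by (auto simp: PiE_def extensional_def sum.insert_if upd)
    show "(\<lambda>f. (f x, f(x := undefined))) ` ?S (insert x A) n \<subseteq> (SIGMA v:{..n}. ?S A (n - v))"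
      using insert.hyps by (auto simp: PiE_def extensional_def sum.insert_if upd)
  qed
  then have "card (?S (insert x A) n) = card (SIGMA v:{..n}. ?S A (n - v))"
    by (simp add: bij_betw_same_card)
  also have "\<dots> = (\<Sum>v\<le>n. card (?S A (n - v)))"
  proof (intro card_SigmaI ballI)
    \<comment> \<open>The induction hypothesis makes the cardinality a positive binomial
      coefficient, whereas infinite sets have cardinality 0.\<close>
    show "finite (?S A (n - v))" for v
      using insert.IH[of "n - v"] by (intro card_ge_0_finite) simp
  qed simp
  also have "\<dots> = (n + card (insert x A)) choose card (insert x A)"
    using insert.hyps sum_choose_diff_eq[of n "card A"] by (simp add: insert.IH)
  finally show ?case .
qed

text \<open>The offset \<open>c\<close> shifts the bound to \<open>m - c\<close>. For
  \<open>c > m\<close> the set is empty and the binomial coefficient vanishes, so small dilates fit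
  the same formula.\<close>

lemma card_sum_add_le:
  assumes "c \<le> CARD('n)"
  shows "card {y :: 'n::finite \<Rightarrow> nat. sum y UNIV + c \<le> m} = (m + CARD('n) - c) choose CARD('n)"
proof (cases "c \<le> m")
  case True
  then have "{y :: 'n \<Rightarrow> nat. sum y UNIV + c \<le> m} = {y \<in> UNIV \<rightarrow>\<^sub>E UNIV. sum y UNIV \<le> m - c}"
    by auto
  then show ?thesis
    using True card_PiE_sum_le[of "UNIV :: 'n set" "m - c"] by simp
next
  case False
  then have "{y :: 'n \<Rightarrow> nat. sum y UNIV + c \<le> m} = {}"
    by auto
  then show ?thesis
    using False assms by (simp only:) (simp add: binomial_eq_0)
qed

lemma finite_sum_add_le: "finite {y :: 'n::finite \<Rightarrow> nat. sum y UNIV + c \<le> m}"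
proof (rule finite_subset)
  show "{y :: 'n \<Rightarrow> nat. sum y UNIV + c \<le> m} \<subseteq> UNIV \<rightarrow>\<^sub>E {..m}"
  proof (clarsimp simp: PiE_UNIV_domain)
    fix y :: "'n \<Rightarrow> nat" and i
    assume "sum y UNIV + c \<le> m"
    moreover have "y i \<le> sum y UNIV"
      by (rule member_le_sum) auto
    ultimately show "y i \<le> m" by simp
  qed
qed (simp add: finite_PiE del: PiE_UNIV_domain)

section \<open>Barycentric coordinates\<close>

text \<open>For a positive last entry of \<open>a\<close>, these are the coordinates of
  \<open>x\<close> in the basis of the nonzero vertices, that is, the barycentric coordinates
  without the weight of the vertex 0.\<close>

definition hnf_coord ::
  "int ^ 'n::{finite,linorder} \<Rightarrow> real ^ 'n::{finite,linorder} \<Rightarrow> 'n::{finite,linorder} \<Rightarrow> real" where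
  "hnf_coord a x i =
    (if i = last_index then x $ i / a $ i else x $ i - a $ i * x $ last_index / a $ last_index)"

text \<open>The nonzero vertices share the index type of the components, with
  \<open>last_index\<close> standing for \<open>a\<close>, so that they pair off with
  \<open>hnf_coord\<close>.\<close>

definition hnf_vertex :: "int ^ 'n::{finite,linorder} \<Rightarrow> 'n \<Rightarrow> real ^ 'n::{finite,linorder}" where
  "hnf_vertex a j = (if j = last_index then (\<chi> i. real_of_int (a $ i)) else axis j 1)"

lemma hnf_coord_linear:
  "hnf_coord a (u *\<^sub>R x + v *\<^sub>R y) i = u * hnf_coord a x i + v * hnf_coord a y i"
  by (simp add: hnf_coord_def algebra_simps add_divide_distrib)

lemma hnf_coord_0: "hnf_coord a 0 i = 0"
  by (simp add: hnf_coord_def)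

lemma hnf_coord_scaleR: "hnf_coord a (u *\<^sub>R x) i = u * hnf_coord a x i"
  using hnf_coord_linear[of a u x 0 0] by simp

lemma hnf_coord_vertex:
  assumes "a $ last_index > 0"
  shows "hnf_coord a (hnf_vertex a j) i = (if i = j then 1 else 0)"
  using assms by (auto simp: hnf_coord_def hnf_vertex_def axis_def)

lemma sum_hnf_coord_vertex:
  assumes "a $ last_index > 0"
  shows "(\<Sum>j\<in>UNIV. hnf_coord a x j *\<^sub>R hnf_vertex a j) = x"
proof (rule vec_eq_iff[THEN iffD2, rule_format])
  fix i :: 'a
  have "(\<Sum>j\<in>UNIV - {last_index}. (hnf_coord a x j *\<^sub>R hnf_vertex a j) $ i) =
      (\<Sum>j\<in>UNIV - {last_index}. if i = j then hnf_coord a x j else 0)"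
    by (intro sum.cong) (auto simp: hnf_vertex_def axis_def)
  then have "(\<Sum>j\<in>UNIV. hnf_coord a x j *\<^sub>R hnf_vertex a j) $ i =
      hnf_coord a x last_index * a $ i +
      (\<Sum>j\<in>UNIV - {last_index}. if i = j then hnf_coord a x j else 0)"
    unfolding sum_component by (subst sum.remove[of _ last_index]) (auto simp: hnf_vertex_def)
  also have "\<dots> = hnf_coord a x last_index * a $ i +
      (if i = last_index then 0 else hnf_coord a x i)"
    by simp
  also have "\<dots> = x $ i"
    using assms by (auto simp: hnf_coord_def)
  finally show "(\<Sum>j\<in>UNIV. hnf_coord a x j *\<^sub>R hnf_vertex a j) $ i = x $ i" .
qed

lemma one_row_hnf_simplex_eq_hull:
  "one_row_hnf_simplex a = convex hull (insert 0 (range (hnf_vertex a)))"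
proof -
  have "{0} \<union> {axis i 1 | i. i \<noteq> last_index} \<union> {\<chi> i. real_of_int (a $ i)} =
      insert 0 (range (hnf_vertex a))"
    by (auto simp: hnf_vertex_def image_def)
  then show ?thesis
    by (simp add: one_row_hnf_simplex_def)
qed

text \<open>The inequalities cut out a convex set containing all vertices. Conversely, the slack in
  the sum inequality serves as the weight of the vertex 0.\<close>

lemma mem_one_row_hnf_simplex_iff:
  assumes "a $ last_index > 0"
  shows "x \<in> one_row_hnf_simplex a \<longleftrightarrow>
    (\<forall>i. 0 \<le> hnf_coord a x i) \<and> (\<Sum>i\<in>UNIV. hnf_coord a x i) \<le> 1"
proof
  let ?C = "{x. (\<forall>i. 0 \<le> hnf_coord a x i) \<and> (\<Sum>i\<in>UNIV. hnf_coord a x i) \<le> 1}"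
  have "convex ?C"
  proof (rule convexI)
    fix x y and u v :: real
    assume xy: "x \<in> ?C" "y \<in> ?C" and uv: "0 \<le> u" "0 \<le> v" "u + v = 1"
    have "(\<Sum>i\<in>UNIV. hnf_coord a (u *\<^sub>R x + v *\<^sub>R y) i) =
        u * (\<Sum>i\<in>UNIV. hnf_coord a x i) + v * (\<Sum>i\<in>UNIV. hnf_coord a y i)"
      by (simp add: hnf_coord_linear sum.distrib sum_distrib_left)
    also have "\<dots> \<le> 1"
      using xy uv by (intro convex_bound_le) auto
    finally show "u *\<^sub>R x + v *\<^sub>R y \<in> ?C"
      using xy uv by (simp add: hnf_coord_linear)
  qed
  moreover have "insert 0 (range (hnf_vertex a)) \<subseteq> ?C"
    using assms by (auto simp: hnf_coord_0 hnf_coord_vertex)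
  ultimately have "one_row_hnf_simplex a \<subseteq> ?C"
    unfolding one_row_hnf_simplex_eq_hull by (intro hull_minimal)
  then show "(\<forall>i. 0 \<le> hnf_coord a x i) \<and> (\<Sum>i\<in>UNIV. hnf_coord a x i) \<le> 1"
    if "x \<in> one_row_hnf_simplex a" using that by blast
next
  assume x: "(\<forall>i. 0 \<le> hnf_coord a x i) \<and> (\<Sum>i\<in>UNIV. hnf_coord a x i) \<le> 1"
  \<comment> \<open>\<open>None\<close> indexes the vertex 0 with the slack as its weight, and
    \<open>Some\<close> the other vertices.\<close>
  define w where "w = case_option (1 - (\<Sum>i\<in>UNIV. hnf_coord a x i)) (hnf_coord a x)"
  define v where "v = case_option 0 (hnf_vertex a)"
  have sum_option: "sum F UNIV = F None + (\<Sum>i\<in>UNIV. F (Some i))"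
    for F :: "'a option \<Rightarrow> 'b::ab_group_add"
    by (simp add: UNIV_option_conv sum.reindex)
  have "(\<Sum>j\<in>UNIV. w j *\<^sub>R v j) \<in> convex hull (insert 0 (range (hnf_vertex a)))"
  proof (rule convex_sum)
    show "sum w UNIV = 1"
      by (simp add: sum_option w_def)
    show "0 \<le> w j" for j
      using x by (cases j) (auto simp: w_def)
    show "v j \<in> convex hull (insert 0 (range (hnf_vertex a)))" for j
      by (cases j) (auto simp: v_def intro: hull_inc)
  qed auto
  then show "x \<in> one_row_hnf_simplex a"
    using assms
    by (simp add: sum_option w_def v_def sum_hnf_coord_vertex one_row_hnf_simplex_eq_hull)
qed

lemma mem_dilated_one_row_hnf_simplex_iff:
  assumes "a $ last_index > 0" and "0 \<le> c"
  shows "x \<in> (*\<^sub>R) c ` one_row_hnf_simplex a \<longleftrightarrow>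
    (\<forall>i. 0 \<le> hnf_coord a x i) \<and> (\<Sum>i\<in>UNIV. hnf_coord a x i) \<le> c"
proof
  assume "x \<in> (*\<^sub>R) c ` one_row_hnf_simplex a"
  then show "(\<forall>i. 0 \<le> hnf_coord a x i) \<and> (\<Sum>i\<in>UNIV. hnf_coord a x i) \<le> c"
    using assms mult_left_le[of _ c]
    by (auto simp: mem_one_row_hnf_simplex_iff hnf_coord_scaleR simp flip: sum_distrib_left)
next
  assume x: "(\<forall>i. 0 \<le> hnf_coord a x i) \<and> (\<Sum>i\<in>UNIV. hnf_coord a x i) \<le> c"
  show "x \<in> (*\<^sub>R) c ` one_row_hnf_simplex a"
  \<comment> \<open>Scaling back by \<open>1 / c\<close> fails for the zeroth dilate, where the
    inequalities force all coordinates to be 0.\<close>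
  proof (cases "c = 0")
    case True
    then have "(\<Sum>i\<in>UNIV. hnf_coord a x i) = 0"
      using x by (simp add: antisym sum_nonneg)
    then have "hnf_coord a x i = 0" for i
      using x by (simp add: sum_nonneg_eq_0_iff)
    then have "x = c *\<^sub>R 0"
      using sum_hnf_coord_vertex[OF assms(1), of x] by simp
    moreover have "0 \<in> one_row_hnf_simplex a"
      using assms by (simp add: mem_one_row_hnf_simplex_iff hnf_coord_0)
    ultimately show ?thesis by blast
  next
    case False
    then have "x = c *\<^sub>R ((1 / c) *\<^sub>R x)"
      by simp
    moreover have "(1 / c) *\<^sub>R x \<in> one_row_hnf_simplex a"
      using assms False x
      by (simp add: mem_one_row_hnf_simplex_iff hnf_coord_scaleR divide_le_eq
          flip: sum_divide_distrib)
    ultimately show ?thesis by blast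
  qed
qed

section \<open>Lattice points of the dilated simplex\<close>

text \<open>Since \<open>N - 1\<close> is -1 modulo \<open>N\<close>, subtracting
  \<open>(N - 1) / N\<close> times the last component leaves the same fraction \<open>s / N\<close>
  as in the last coordinate. One formula therefore covers all indices.\<close>

lemma hnf_coord_lattice_point:
  assumes "a = (\<chi> i. if i = last_index then int N else int N - 1)" and "N > 0"
    and "x $ last_index = N * q + s"
  shows "hnf_coord a x i = x $ i - (real N - 1) * q - s + s / N"
  using assms by (auto simp: hnf_coord_def field_simps)

lemma of_nat_add_real_le_of_nat_iff:
  assumes "0 \<le> u"
  shows "real n + u \<le> real m \<longleftrightarrow> n + nat \<lceil>u\<rceil> \<le> m"
proof -
  have "real n + u \<le> real m \<longleftrightarrow> \<lceil>u\<rceil> \<le> int m - int n"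
    unfolding ceiling_le_iff by auto
  also have "\<dots> \<longleftrightarrow> n + nat \<lceil>u\<rceil> \<le> m"
    using assms zero_le_ceiling[of u] by linarith
  finally show ?thesis .
qed

lemma card_dilated_simplex_lattice_points:
  fixes a :: "int ^ 'n::{finite,linorder}"
  assumes a: "a = (\<chi> i. if i = last_index then int N else int N - 1)" and N: "N > 0"
  defines "d \<equiv> CARD('n)"
  shows "card ((*\<^sub>R) (real m) ` one_row_hnf_simplex a \<inter> integer_points) =
    (\<Sum>s<N. (m + d - nat \<lceil>real (d * s) / real N\<rceil>) choose d)"
proof -
  let ?l = "last_index :: 'n"
  let ?c = "\<lambda>s. nat \<lceil>real (d * s) / real N\<rceil>"
  define T where "T = (SIGMA s:{..<N}. {y :: 'n \<Rightarrow> nat. sum y UNIV + ?c s \<le> m})"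
  \<comment> \<open>The lattice point with barycentric coordinates \<open>y i + s / N\<close>. Its
    last component is \<open>N * y ?l + s\<close>, which reveals \<open>s\<close> modulo
    \<open>N\<close>.\<close>
  define \<Phi> where "\<Phi> = (\<lambda>(s, y). \<chi> i. real (y i + (N - 1) * y ?l + s) :: real ^ 'n::{finite,linorder})"
  let ?P = "(*\<^sub>R) (real m) ` one_row_hnf_simplex a \<inter> integer_points"
  have a_last: "a $ ?l > 0"
    using a N by simp
  have last: "\<Phi> (s, y) $ ?l = N * y ?l + s" for s y
  proof -
    have "y ?l + (N - 1) * y ?l + s = N * y ?l + s"
      using N by (cases N) auto
    then have "real (y ?l + (N - 1) * y ?l + s) = real (N * y ?l + s)"
      by (simp only:)
    then show ?thesis by (simp add: \<Phi>_def)
  qed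
  have coord: "hnf_coord a (\<Phi> (s, y)) i = y i + s / N" for s y i
  proof -
    have "hnf_coord a (\<Phi> (s, y)) i =
        \<Phi> (s, y) $ i - (real N - 1) * real_of_int (int (y ?l)) - real_of_int (int s) +
        real_of_int (int s) / N"
      by (rule hnf_coord_lattice_point[OF a N]) (simp add: last)
    then show ?thesis
      using N by (simp add: \<Phi>_def of_nat_diff)
  qed
  have sum_coord: "(\<Sum>i\<in>UNIV. y i + real s / N) \<le> m \<longleftrightarrow> sum y UNIV + ?c s \<le> m"
    for s and y :: "'n \<Rightarrow> nat"
    using of_nat_add_real_le_of_nat_iff[of "real (d * s) / real N" "sum y UNIV" m]
    by (simp add: sum.distrib d_def)
  have "\<Phi> ` T = ?P"
  proof
    show "\<Phi> ` T \<subseteq> ?P"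
    proof
      fix x assume "x \<in> \<Phi> ` T"
      then obtain s y where x: "x = \<Phi> (s, y)" and T: "(s, y) \<in> T" by auto
      have "x \<in> (*\<^sub>R) (real m) ` one_row_hnf_simplex a"
        using T by (simp add: mem_dilated_one_row_hnf_simplex_iff[OF a_last] x coord sum_coord T_def)
      moreover have "x \<in> integer_points"
        unfolding x by (simp add: \<Phi>_def integer_points_def)
      ultimately show "x \<in> ?P" by blast
    qed
    show "?P \<subseteq> \<Phi> ` T"
    proof
      fix x assume "x \<in> ?P"
      then have pos: "\<And>i. 0 \<le> hnf_coord a x i"
        and le: "(\<Sum>i\<in>UNIV. hnf_coord a x i) \<le> m" and "\<forall>i. \<exists>z :: int. x $ i = z"
        by (auto simp: mem_dilated_one_row_hnf_simplex_iff[OF a_last] integer_points_def elim!: Ints_cases)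
      then obtain z :: "'n \<Rightarrow> int" where z: "\<And>i. x $ i = z i"
        by metis
      have "0 \<le> z ?l"
        using pos[of ?l] a N by (simp add: hnf_coord_def z zero_le_divide_iff)
      \<comment> \<open>The last barycentric coordinate has integer part \<open>q\<close> and
        fractional part \<open>s / N\<close>; \<open>w\<close> collects the integer parts of all
        coordinates.\<close>
      define s q where "s = z ?l mod int N" and "q = z ?l div int N"
      define w where "w = (\<lambda>i. z i - (int N - 1) * q - s)"
      have zl: "z ?l = int N * q + s" and s: "0 \<le> s" "s < int N" and q: "0 \<le> q"
        using N \<open>0 \<le> z ?l\<close> by (auto simp: s_def q_def pos_imp_zdiv_nonneg_iff)
      have xl: "x $ ?l = N * real_of_int q + real_of_int s"
        using zl by (simp add: z)
      have cx: "hnf_coord a x i = w i + s / N" for i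
        using hnf_coord_lattice_point[OF a N xl, of i] by (simp add: z w_def)
      \<comment> \<open>From \<open>w i + s / N \<ge> 0\<close> and \<open>s / N < 1\<close> it
        follows that the integer \<open>w i\<close> exceeds -1.\<close>
      have w: "0 \<le> w i" for i
      proof -
        have "s / N < 1"
          using s N by simp
        then have "real_of_int (w i) > - 1"
          using pos[of i] by (simp add: cx)
        then show ?thesis by linarith
      qed
      have wl: "w ?l = q"
        by (simp add: w_def zl algebra_simps)
      define y where "y = (\<lambda>i. nat (w i))"
      have y: "int (y i) = w i" for i
        using w by (simp add: y_def)
      have yr: "real (y i) = w i" for i
        using w by (simp add: y_def)
      have sr: "real (nat s) = s"
        using s by simp
      have "x = \<Phi> (nat s, y)"
      proof (rule vec_eq_iff[THEN iffD2, rule_format])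
        fix i
        have "int (y i + (N - 1) * y ?l + nat s) = z i"
          using N s by (simp add: y wl of_nat_diff) (simp add: w_def)
        then have "real_of_int (int (y i + (N - 1) * y ?l + nat s)) = x $ i"
          by (simp only: z)
        then show "x $ i = \<Phi> (nat s, y) $ i"
          using s by (simp add: \<Phi>_def)
      qed
      moreover have "(nat s, y) \<in> T"
        using le sum_coord[of y "nat s"] s by (auto simp: T_def cx yr sr)
      ultimately show "x \<in> \<Phi> ` T" by blast
    qed
  qed
  moreover have "inj_on \<Phi> T"
  proof (rule inj_onI, clarify)
    fix s s' y y'
    assume T: "(s, y) \<in> T" "(s', y') \<in> T" and eq: "\<Phi> (s, y) = \<Phi> (s', y')"
    have "real (N * y ?l + s) = real (N * y' ?l + s')"
      using last[of s y] last[of s' y'] eq by simp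
    then have l: "N * y ?l + s = N * y' ?l + s'"
      by (simp only: of_nat_eq_iff)
    moreover have "s < N" "s' < N"
      using T by (auto simp: T_def)
    ultimately have s: "s = s'"
      by (metis mod_less mod_mult_self4)
    moreover have "y i = y' i" for i
      using coord[of s y i] coord[of s' y' i] eq s by simp
    ultimately show "s = s' \<and> y = y'"
      by auto
  qed
  ultimately have "card ?P = card T"
    by (metis card_image)
  also have "\<dots> = (\<Sum>s<N. card {y :: 'n \<Rightarrow> nat. sum y UNIV + ?c s \<le> m})"
    unfolding T_def by (rule card_SigmaI) (auto intro: finite_sum_add_le)
  also have "\<dots> = (\<Sum>s<N. (m + d - ?c s) choose d)"
  proof (rule sum.cong)
    fix s assume "s \<in> {..<N}"
    then have "real d * (real s / real N) \<le> real d"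
      by (intro mult_left_le) auto
    then have "?c s \<le> CARD('n)"
      by (simp add: d_def ceiling_le_iff)
    then show "card {y :: 'n \<Rightarrow> nat. sum y UNIV + ?c s \<le> m} = (m + d - ?c s) choose d"
      unfolding d_def by (rule card_sum_add_le)
  qed simp
  finally show ?thesis .
qed

section \<open>The Ehrhart polynomials\<close>

text \<open>The range splits into \<open>d\<close> blocks of length \<open>k\<close>, on each of
  which \<open>s div k\<close> is constant.\<close>

lemma sum_div_blocks:
  fixes F :: "nat \<Rightarrow> 'b::comm_semiring_1"
  assumes "k > 0"
  shows "(\<Sum>s<d * k. F (s div k)) = of_nat k * (\<Sum>i<d. F i)"
proof -
  have "(\<Sum>s<d * k. F (s div k)) = (\<Sum>i<d. \<Sum>s = i * k..<i * k + k. F (s div k))"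
    by (rule sum.nat_group[symmetric])
  also have "\<dots> = (\<Sum>i<d. \<Sum>s = i * k..<i * k + k. F i)"
  proof (intro sum.cong refl)
    fix i s assume "s \<in> {i * k..<i * k + k}"
    then have "s div k = i"
      using assms by (intro div_nat_eqI) (auto simp: algebra_simps)
    then show "F (s div k) = F i" by simp
  qed
  finally show ?thesis
    by (simp add: sum_distrib_left)
qed

lemma nat_ceiling_eqI:
  assumes "real n < u" "u \<le> real n + 1"
  shows "nat \<lceil>u\<rceil> = Suc n"
proof -
  have "\<lceil>u\<rceil> = int n + 1"
    using assms by (intro ceiling_unique) auto
  then show ?thesis by simp
qed

text \<open>Pascal's rule absorbs the term added at each step. For \<open>e = d\<close> this
  evaluates \<open>g_poly\<close> at natural numbers; the form with \<open>+\<close> avoids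
  truncated subtraction.\<close>

lemma sum_choose_block:
  "(\<Sum>i<e. (m + e - Suc i) choose d) + (m choose Suc d) = (m + e) choose Suc d"
proof (induction e)
  case 0
  then show ?case by simp
next
  case (Suc e)
  have "(\<Sum>i<Suc e. (m + Suc e - Suc i) choose d) =
      ((m + e) choose d) + (\<Sum>i<e. (m + e - Suc i) choose d)"
    by (subst sum.lessThan_Suc_shift) simp
  then show ?case
    using Suc by simp
qed

lemma poly_binom_poly_of_nat: "poly (binom_poly c n) (real m) = real ((m + c) choose n)"
  by (simp add: poly_binom_poly binomial_gbinomial)

lemma poly_g_poly_of_nat: "poly (g_poly d) (real m) = real (\<Sum>i<d. (m + d - Suc i) choose d)"
proof -
  have "real ((m + d) choose Suc d) =
      real (\<Sum>i<d. (m + d - Suc i) choose d) + real (m choose Suc d)"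
    unfolding sum_choose_block[of m d d, symmetric] by (simp only: of_nat_add)
  then show ?thesis
    by (simp add: g_poly_def poly_binom_poly_of_nat)
qed

text \<open>The residue 0 contributes \<open>h_poly\<close>. The other \<open>d * k\<close> residues
  fall into \<open>d\<close> blocks of length \<open>k\<close> with ceilings 1 to \<open>d\<close>,
  and contribute \<open>k\<close> copies of \<open>g_poly\<close>.\<close>

lemma lattice_point_sum_h:
  assumes "k > 0" "d > 0"
  shows "real (\<Sum>s<d * k + 1. (m + d - nat \<lceil>real (d * s) / real (d * k + 1)\<rceil>) choose d) =
    poly (h_poly d + smult (real k) (g_poly d)) (real m)"
proof -
  have "nat \<lceil>real (d * Suc s) / real (d * k + 1)\<rceil> = Suc (s div k)" if "s < d * k" for s
  proof (rule nat_ceiling_eqI)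
    have pos: "0 < real (d * k + 1)"
      by (simp only: of_nat_0_less_iff)
    have q: "s div k < d"
      using that assms by (simp add: div_less_iff_less_mult)
    \<comment> \<open>The lower bound is strict because \<open>k * (s div k) \<le> s\<close> and
      \<open>s div k < d\<close>.\<close>
    have "s div k * (d * k + 1) = d * (k * (s div k)) + s div k"
      by (simp add: algebra_simps)
    also have "\<dots> < d * s + d"
      using q by (intro add_le_less_mono mult_le_mono) auto
    finally have "real (s div k * (d * k + 1)) < real (d * Suc s)"
      by (simp only: of_nat_less_iff) simp
    then show "real (s div k) < real (d * Suc s) / real (d * k + 1)"
      unfolding of_nat_mult[of "s div k"] by (simp only: pos_less_divide_eq[OF pos])
    have "Suc s \<le> k * (s div k + 1)"
      using assms dividend_less_div_times[of k s] by (simp add: algebra_simps)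
    then have "d * Suc s \<le> d * (k * (s div k + 1))"
      by (rule mult_le_mono2)
    also have "\<dots> \<le> (s div k + 1) * (d * k + 1)"
      by (simp add: algebra_simps)
    finally have "real (d * Suc s) \<le> real ((s div k + 1) * (d * k + 1))"
      by (simp only: of_nat_le_iff)
    also have "real ((s div k + 1) * (d * k + 1)) = (real (s div k) + 1) * real (d * k + 1)"
      unfolding of_nat_mult[of "s div k + 1"] by simp
    finally show "real (d * Suc s) / real (d * k + 1) \<le> real (s div k) + 1"
      by (simp only: pos_divide_le_eq[OF pos])
  qed
  then have "(\<Sum>s<d * k. (m + d - nat \<lceil>real (d * Suc s) / real (d * k + 1)\<rceil>) choose d) =
      (\<Sum>s<d * k. (m + d - Suc (s div k)) choose d)"
    by (intro sum.cong) auto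
  also have "\<dots> = k * (\<Sum>i<d. (m + d - Suc i) choose d)"
    using sum_div_blocks[OF assms(1), where F = "\<lambda>i. (m + d - Suc i) choose d"] by simp
  finally have "(\<Sum>s<d * k + 1. (m + d - nat \<lceil>real (d * s) / real (d * k + 1)\<rceil>) choose d) =
      ((m + d) choose d) + k * (\<Sum>i<d. (m + d - Suc i) choose d)"
    by (simp only: Suc_eq_plus1[symmetric] sum.lessThan_Suc_shift) simp
  then show ?thesis
    by (simp only:) (simp add: h_poly_def poly_binom_poly_of_nat poly_g_poly_of_nat)
qed

text \<open>After the residue 0 only \<open>d * k - 1\<close> residues remain, so the last block is
  one short. Its missing term \<open>m choose d\<close> is the binomial subtracted in
  \<open>f_poly\<close>.\<close>

lemma lattice_point_sum_f:
  assumes "k > 0" "d > 0"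
  shows "real (\<Sum>s<d * k. (m + d - nat \<lceil>real (d * s) / real (d * k)\<rceil>) choose d) =
    poly (f_poly d + smult (real k) (g_poly d)) (real m)"
proof -
  have ceil: "nat \<lceil>real (d * Suc s) / real (d * k)\<rceil> = Suc (s div k)" for s
  proof (rule nat_ceiling_eqI)
    have cancel: "real (d * Suc s) / real (d * k) = real (Suc s) / real k"
      unfolding of_nat_mult using assms by (simp del: of_nat_Suc)
    have "s div k * k < Suc s"
      by (simp add: le_imp_less_Suc)
    then have "real (s div k * k) < real (Suc s)"
      by (simp only: of_nat_less_iff)
    then show "real (s div k) < real (d * Suc s) / real (d * k)"
      unfolding cancel using assms by (simp add: pos_less_divide_eq)
    have "Suc s \<le> (s div k + 1) * k"
      using assms dividend_less_div_times[of k s] by (simp add: algebra_simps)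
    then have "real (Suc s) \<le> real ((s div k + 1) * k)"
      by (simp only: of_nat_le_iff)
    then show "real (d * Suc s) / real (d * k) \<le> real (s div k) + 1"
      unfolding cancel of_nat_mult using assms by (simp add: pos_divide_le_eq add.commute)
  qed
  \<comment> \<open>After the shift by one, \<open>M\<close> is the index missing from the last
    block.\<close>
  obtain M where M: "d * k = Suc M"
    using assms by (cases "d * k") auto
  have "M div k = d - 1"
  proof (rule div_nat_eqI)
    show "k * (d - 1) \<le> M" "M < k * Suc (d - 1)"
      using M assms by (auto simp: diff_mult_distrib2 mult.commute)
  qed
  then have last: "(m + d - Suc (M div k)) choose d = m choose d"
    using assms by simp
  have shift: "sum F {..<d * k} = F 0 + (\<Sum>s<M. F (Suc s))" for F :: "nat \<Rightarrow> nat"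
    unfolding M by (rule sum.lessThan_Suc_shift)
  have "(\<Sum>s<d * k. (m + d - nat \<lceil>real (d * s) / real (d * k)\<rceil>) choose d) =
      ((m + d) choose d) + (\<Sum>s<M. (m + d - Suc (s div k)) choose d)"
    unfolding shift ceil by simp
  moreover have "(\<Sum>s<M. (m + d - Suc (s div k)) choose d) + (m choose d) =
      k * (\<Sum>i<d. (m + d - Suc i) choose d)"
    using sum_div_blocks[OF assms(1), where F = "\<lambda>i. (m + d - Suc i) choose d" and d = d] M last
    by simp
  ultimately have "(\<Sum>s<d * k. (m + d - nat \<lceil>real (d * s) / real (d * k)\<rceil>) choose d) + (m choose d) =
      ((m + d) choose d) + k * (\<Sum>i<d. (m + d - Suc i) choose d)"
    by simp
  then have "real (\<Sum>s<d * k. (m + d - nat \<lceil>real (d * s) / real (d * k)\<rceil>) choose d) + real (m choose d) =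
      real ((m + d) choose d) + real k * real (\<Sum>i<d. (m + d - Suc i) choose d)"
    by (simp only: of_nat_add[symmetric] of_nat_mult[symmetric])
  then show ?thesis
    by (simp only: f_poly_def poly_add poly_diff poly_smult poly_binom_poly_of_nat poly_g_poly_of_nat)
      simp
qed

section \<open>Coefficients of \<open>g\<close>\<close>

text \<open>Up to the sign \<open>(-1) ^ n\<close>, the product on the left is the one on the right
  with the variable negated.\<close>

lemma coeff_prod_linear_minus:
  fixes c :: "nat \<Rightarrow> 'b::comm_ring_1"
  shows "coeff (\<Prod>i<n. [:- c i, 1:]) j = (-1) ^ (n + j) * coeff (\<Prod>i<n. [:c i, 1:]) j"
proof (induction n arbitrary: j)
  case 0
  then show ?case by (cases j) auto
next
  case (Suc n)
  then show ?case
    by (cases j) (auto simp: algebra_simps)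
qed

text \<open>The coefficients are elementary symmetric functions of the positive numbers
  \<open>c i\<close>.\<close>

lemma coeff_prod_linear_pos:
  fixes c :: "nat \<Rightarrow> 'b::linordered_idom"
  assumes "\<And>i. i < n \<Longrightarrow> 0 < c i"
  shows "j \<le> n \<Longrightarrow> 0 < coeff (\<Prod>i<n. [:c i, 1:]) j"
    and "j > n \<Longrightarrow> coeff (\<Prod>i<n. [:c i, 1:]) j = 0"
proof -
  \<comment> \<open>Both claims go through one induction: positivity of the new top coefficient uses
    that the old product has coefficient 0 there.\<close>
  have "(j \<le> n \<longrightarrow> 0 < coeff (\<Prod>i<n. [:c i, 1:]) j) \<and> (j > n \<longrightarrow> coeff (\<Prod>i<n. [:c i, 1:]) j = 0)"
    using assms
  proof (induction n arbitrary: j)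
    case 0
    then show ?case by (cases j) auto
  next
    case (Suc n)
    have IH: "(j \<le> n \<longrightarrow> 0 < coeff (\<Prod>i<n. [:c i, 1:]) j) \<and>
        (j > n \<longrightarrow> coeff (\<Prod>i<n. [:c i, 1:]) j = 0)" for j
      using Suc by simp
    show ?case
    proof (cases j)
      case 0
      then show ?thesis
        using IH[of 0] Suc.prems[of n] by (simp add: mult.commute)
    next
      case (Suc j')
      have "0 < c n" using Suc.prems by simp
      moreover have "0 \<le> coeff (\<Prod>i<n. [:c i, 1:]) (Suc j')"
        using IH[of "Suc j'"] by (cases "Suc j' \<le> n") auto
      ultimately show ?thesis
        using Suc IH[of j'] IH[of "Suc j'"] by (auto simp: mult.commute intro: add_nonneg_pos)
    qed
  qed
  then show "j \<le> n \<Longrightarrow> 0 < coeff (\<Prod>i<n. [:c i, 1:]) j"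
    "j > n \<Longrightarrow> coeff (\<Prod>i<n. [:c i, 1:]) j = 0" by auto
qed

text \<open>Both binomials contain the factor \<open>t\<close>, hence the shift to
  \<open>Suc j\<close>. The remaining factors are \<open>t + i\<close> and \<open>t - i\<close> for
  \<open>i\<close> from 1 to \<open>d\<close>, so their coefficients agree up to the sign
  \<open>(-1) ^ (d + j)\<close>.\<close>

lemma coeff_g_poly_Suc:
  "coeff (g_poly d) (Suc j) =
    (1 - (-1) ^ (d + j)) * coeff (\<Prod>i<d. [:real (Suc i), 1:]) j / fact (d + 1)"
proof -
  have "(\<Prod>i<Suc d. [:real d - real i, 1:]) = (\<Prod>i<Suc d. [:real (Suc d - Suc i), 1:])"
    by (intro prod.cong) (auto simp: of_nat_diff)
  also have "\<dots> = (\<Prod>i<Suc d. [:real i, 1:])"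
    by (rule prod.nat_diff_reindex)
  also have "\<dots> = [:0, 1:] * (\<Prod>i<d. [:real (Suc i), 1:])"
    by (subst prod.lessThan_Suc_shift) simp
  finally have 1: "(\<Prod>i<Suc d. [:real d - real i, 1:]) = [:0, 1:] * (\<Prod>i<d. [:real (Suc i), 1:])" .
  have 2: "(\<Prod>i<Suc d. [:real 0 - real i, 1:]) = [:0, 1:] * (\<Prod>i<d. [:- real (Suc i), 1:])"
    by (subst prod.lessThan_Suc_shift) simp
  show ?thesis
    unfolding g_poly_def binom_poly_def Suc_eq_plus1[symmetric] 1 2 coeff_diff coeff_smult
    by (simp add: coeff_prod_linear_minus[of "\<lambda>i. real (Suc i)" d j] field_simps del: of_nat_Suc)
qed

lemma coeff_g_poly_pos:
  assumes "0 < j" "j \<le> d" "even (d + j)"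
  shows "0 < coeff (g_poly d) j"
proof (cases j)
  case (Suc i)
  then show ?thesis
    using assms coeff_prod_linear_pos(1)[of d "\<lambda>i. real (Suc i)" i]
    by (simp add: coeff_g_poly_Suc)
qed (use assms in simp)

lemma coeff_g_poly_eq_0:
  assumes "0 < j" "odd (d + j) \<or> d < j"
  shows "coeff (g_poly d) j = 0"
proof (cases j)
  case (Suc i)
  show ?thesis
  proof (cases "odd (d + j)")
    case False
    \<comment> \<open>The borderline value \<open>i = d\<close> would make \<open>d + j\<close>
      odd.\<close>
    then have "i > d"
      using assms Suc by (cases "i = d") auto
    then show ?thesis
      using coeff_prod_linear_pos(2)[of d "\<lambda>i. real (Suc i)" i] Suc by (simp add: coeff_g_poly_Suc)
  qed (use Suc in \<open>simp add: coeff_g_poly_Suc\<close>)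
qed (use assms in simp)

lemma degree_binom_poly: "degree (binom_poly c n) = n"
  by (simp add: binom_poly_def degree_prod_eq_sum_degree)

lemma coeff_binom_poly_top: "coeff (binom_poly c n) n = 1 / fact n"
proof -
  have "lead_coeff (\<Prod>i<n. [:real c - real i, 1:]) = 1"
    by (simp only: lead_coeff_prod) simp
  moreover have "degree (\<Prod>i<n. [:real c - real i, 1:]) = n"
    by (simp add: degree_prod_eq_sum_degree)
  ultimately show ?thesis by (simp add: binom_poly_def)
qed

text \<open>The top coefficient is supplied by \<open>g_poly\<close>. Asking only for
  \<open>0 \<le> coeff p d\<close> admits \<open>f_poly\<close>, whose terms of degree
  \<open>d\<close> cancel.\<close>

lemma degree_add_smult_g_poly:
  assumes "k > 0" "d > 0" "degree p \<le> d" "0 \<le> coeff p d"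
  shows "degree (p + smult (real k) (g_poly d)) = d"
proof (rule antisym)
  show "degree (p + smult (real k) (g_poly d)) \<le> d"
    using assms by (intro degree_le) (auto simp: coeff_eq_0 coeff_g_poly_eq_0)
  have "0 < coeff (p + smult (real k) (g_poly d)) d"
    using assms coeff_g_poly_pos[of d d] by (simp add: add_nonneg_pos)
  then show "d \<le> degree (p + smult (real k) (g_poly d))"
    by (intro le_degree) simp
qed

section \<open>Failure of unimodality\<close>

text \<open>A peak beyond \<open>r\<close> contradicts the drop after \<open>r\<close>, and a peak
  at or before \<open>r\<close> contradicts the rise after \<open>r + 1\<close>.\<close>

lemma not_unimodal_polyI:
  assumes "coeff p (r + 1) < coeff p r" "coeff p (r + 1) < coeff p (r + 2)" "r + 2 \<le> d"
  shows "\<not> unimodal_poly d p"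
proof
  assume "unimodal_poly d p"
  then obtain i where i: "\<And>j. j < i \<Longrightarrow> coeff p j \<le> coeff p (j + 1)"
    "\<And>j. i \<le> j \<Longrightarrow> j < d \<Longrightarrow> coeff p j \<ge> coeff p (j + 1)"
    by (auto simp: unimodal_poly_def)
  show False
    using i(1)[of r] i(2)[of "r + 1"] assms by (cases "r < i") auto
qed

text \<open>As \<open>r\<close> has the parity of \<open>d\<close>, adding \<open>k\<close> copies
  of \<open>g_poly\<close> raises the coefficients at \<open>r\<close> and \<open>r + 2\<close> and
  leaves the one at \<open>r + 1\<close> unchanged. The bound on \<open>k\<close> is what makes both
  neighbours strictly larger.\<close>

lemma not_unimodal_add_smult_g_poly:
  assumes d: "d \<ge> 3" and k: "int k \<ge> K_bound p d"
  shows "\<not> unimodal_poly d (p + smult (real k) (g_poly d))"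
proof -
  define r where "r = r_index d"
  have r: "0 < r" "r + 2 \<le> d" "even (d + r)"
    using d by (auto simp: r_def r_index_def elim!: evenE)
  have g: "0 < coeff (g_poly d) r" "0 < coeff (g_poly d) (r + 2)" "coeff (g_poly d) (r + 1) = 0"
    using r by (auto intro!: coeff_g_poly_pos coeff_g_poly_eq_0)
  let ?x = "(coeff p (r + 1) - coeff p r) / coeff (g_poly d) r"
  let ?y = "(coeff p (r + 1) - coeff p (r + 2)) / coeff (g_poly d) (r + 2)"
  have "1 + \<lfloor>max ?x ?y\<rfloor> \<le> int k"
    using k by (simp add: K_bound_def Let_def r_def)
  \<comment> \<open>The summand 1 added to the floor makes this inequality strict.\<close>
  then have "max ?x ?y < real k"
    by linarith
  then have "coeff p (r + 1) - coeff p r < real k * coeff (g_poly d) r"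
    and "coeff p (r + 1) - coeff p (r + 2) < real k * coeff (g_poly d) (r + 2)"
    using g(1,2) by (simp_all add: pos_divide_less_eq del: add_2_eq_Suc')
  then show ?thesis
    using g(3) r by (intro not_unimodal_polyI[of _ r]) (auto simp del: add_2_eq_Suc')
qed

lemma is_ehrhart_polyI:
  fixes a :: "int ^ 'n::{finite,linorder}"
  assumes "a = (\<chi> i. if i = last_index then int N else int N - 1)" and "N > 0"
    and "degree p = CARD('n)"
    and "\<And>m. real (\<Sum>s<N. (m + CARD('n) - nat \<lceil>real (CARD('n) * s) / real N\<rceil>) choose CARD('n)) =
      poly p (real m)"
  shows "is_ehrhart_poly (one_row_hnf_simplex a) p"
  unfolding is_ehrhart_poly_def card_dilated_simplex_lattice_points[OF assms(1,2)] assms(4)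
  using assms(3) by simp

theorem theorem4p8:
  fixes d k N :: nat
    and a :: "int ^ 'n::{finite,linorder}"
  assumes "d = CARD('n)" and "d \<ge> 3" and "k > 0"
    and "a = (\<chi> i. if i = last_index then int N else int N - 1)"
  shows "(N = d * k + 1 \<and> int k \<ge> K_bound (h_poly d) d
            \<longrightarrow> \<not> unimodal_poly d (ehrhart_poly (one_row_hnf_simplex a))) \<and>
         (N = d * k \<and> int k \<ge> K_bound (f_poly d) d
            \<longrightarrow> \<not> unimodal_poly d (ehrhart_poly (one_row_hnf_simplex a)))"
proof (intro conjI impI; elim conjE)
  assume N: "N = d * k + 1" and k: "int k \<ge> K_bound (h_poly d) d"
  have "degree (h_poly d + smult (real k) (g_poly d)) = CARD('n)"
    using degree_add_smult_g_poly[of k d "h_poly d"] assms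
    by (simp add: h_poly_def degree_binom_poly coeff_binom_poly_top)
  then have "is_ehrhart_poly (one_row_hnf_simplex a) (h_poly d + smult (real k) (g_poly d))"
    using lattice_point_sum_h[of k d] assms(1-3) N
    by (intro is_ehrhart_polyI[OF assms(4)]) auto
  then show "\<not> unimodal_poly d (ehrhart_poly (one_row_hnf_simplex a))"
    using not_unimodal_add_smult_g_poly[OF assms(2) k] by (simp add: ehrhart_poly_eqI)
next
  assume N: "N = d * k" and k: "int k \<ge> K_bound (f_poly d) d"
  have "degree (f_poly d + smult (real k) (g_poly d)) = CARD('n)"
    using degree_add_smult_g_poly[of k d "f_poly d"] assms
    by (simp add: f_poly_def degree_binom_poly coeff_binom_poly_top degree_diff_le)
  then have "is_ehrhart_poly (one_row_hnf_simplex a) (f_poly d + smult (real k) (g_poly d))"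
    using lattice_point_sum_f[of k d] assms(1-3) N
    by (intro is_ehrhart_polyI[OF assms(4)]) auto
  then show "\<not> unimodal_poly d (ehrhart_poly (one_row_hnf_simplex a))"
    using not_unimodal_add_smult_g_poly[OF assms(2) k] by (simp add: ehrhart_poly_eqI)
qed

end
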